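(* Let $n\ge 2$, $d,k\ge 1$ be integers, let $\mathbf{X}\in\mathbb{R}^{n\times d}$ be a data matrix and $\mathbf{Y}\in\mathbb{R}^{n\times 1}$ a vector of labels, let $\sigma>0$, and let $\mathbf{L_X}=\mathbf{L}(\mathbf{X},\sigma)$ and $\mathbf{L_Y}=\mathbf{L}(\mathbf{Y},\sigma)$ be the associated Gaussian-kernel graph Laplacians ($n\times n$ matrices, fixed throughout the iteration). Fix $\alpha\ge 0$. For an arbitrary initial matrix $\mathbf{X}_0\in\mathbb{R}^{n\times k}$ define, for $t\ge 1$, $$\mathbf{X}_t=\tfrac12\,\mathrm{Diag}(\mathbf{L_X})^{-1}\left[\alpha\mathbf{L_Y}-\mathbf{L_X}\right]\mathbf{X}_{t-1}+\mathbf{X}_{t-1}.$$ Then this iteration monotonically decreases the objective $$v(\mathbf{Z})=\mathrm{Tr}(\mathbf{Z}^T\mathbf{L_X}\mathbf{Z})-\alpha\,\mathrm{Tr}(\mathbf{Z}^T\mathbf{L_Y}\mathbf{Z}),\qquad \mathbf{Z}\in\mathbb{R}^{n\times k},$$ that is, $v(\mathbf{X}_t)\le v(\mathbf{X}_{t-1})$ for every $t\ge 1$.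
   Context: For a matrix $\mathbf{A}$ with $n$ rows $\mathbf{A}_1,\dots,\mathbf{A}_n$ and a bandwidth $\sigma>0$, the Gaussian-kernel graph Laplacian $\mathbf{L}(\mathbf{A},\sigma)\in\mathbb{R}^{n\times n}$ has off-diagonal entries $\mathbf{L}(\mathbf{A},\sigma)_{ij}=-e^{-\Vert\mathbf{A}_i-\mathbf{A}_j\Vert^2/\sigma}$ for $i\ne j$ and diagonal entries $\mathbf{L}(\mathbf{A},\sigma)_{ii}=\sum_{j\ne i}e^{-\Vert\mathbf{A}_i-\mathbf{A}_j\Vert^2/\sigma}$. For a square matrix $\mathbf{L}$, $\mathrm{Diag}(\mathbf{L})$ is the diagonal matrix with the same diagonal as $\mathbf{L}$. The Laplacians are computed once from the data $\mathbf{X},\mathbf{Y}$ and do not change with $t$; the iterates $\mathbf{X}_t$ are embeddings of the $n$ data points in $\mathbb{R}^k$. *)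

theory Defs
  imports "HOL-Analysis.Analysis"
begin

text \<open>A matrix with m rows and d columns has type \<open>real ^ 'd ^ 'm\<close>, so \<open>A $ i\<close> is its row i.
  In the kernel the squared distance is divided by the bandwidth itself, not by its square.\<close>

definition gauss_laplacian :: "real ^ 'd ^ 'n \<Rightarrow> real \<Rightarrow> real ^ 'n ^ 'n" where
  "gauss_laplacian A \<sigma> =
     (\<chi> i j. if i = j then (\<Sum>l\<in>UNIV - {i}. exp (- ((norm (A $ i - A $ l))\<^sup>2 / \<sigma>)))
            else - exp (- ((norm (A $ i - A $ j))\<^sup>2 / \<sigma>)))"

definition Diag :: "real ^ 'n ^ 'n \<Rightarrow> real ^ 'n ^ 'n" where
  "Diag L = (\<chi> i j. if i = j then L $ i $ i else 0)"

definition objective ::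
    "real ^ 'n ^ 'n \<Rightarrow> real ^ 'n ^ 'n \<Rightarrow> real \<Rightarrow> real ^ 'k ^ 'n \<Rightarrow> real" where
  "objective LX LY \<alpha> Z =
     trace (transpose Z ** LX ** Z) - \<alpha> * trace (transpose Z ** LY ** Z)"

primrec iterate ::
    "real ^ 'n ^ 'n \<Rightarrow> real ^ 'n ^ 'n \<Rightarrow> real \<Rightarrow> real ^ 'k ^ 'n \<Rightarrow> nat \<Rightarrow> real ^ 'k ^ 'n" where
  "iterate LX LY \<alpha> X0 0 = X0"
| "iterate LX LY \<alpha> X0 (Suc t) =
     (1 / 2) *\<^sub>R (matrix_inv (Diag LX) ** (\<alpha> *\<^sub>R LY - LX) ** iterate LX LY \<alpha> X0 t)
       + iterate LX LY \<alpha> X0 t"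

end

theory Submission
  imports Defs
begin

text \<open>Put \<open>N = \<alpha> L\<^sub>Y - L\<^sub>X\<close> and \<open>D = Diag L\<^sub>X\<close>. The step \<open>W = X\<^sub>t - X\<^sub>t\<^sub>-\<^sub>1\<close> satisfies
  \<open>N X\<^sub>t\<^sub>-\<^sub>1 = 2 D W\<close>, so expanding the quadratic form gives
  \<open>v(X\<^sub>t) - v(X\<^sub>t\<^sub>-\<^sub>1) = - 4 \<langle>W, D W\<rangle> + \<langle>W, L\<^sub>X W\<rangle> - \<alpha> \<langle>W, L\<^sub>Y W\<rangle>\<close>.
  Both Laplacians are positive semidefinite and \<open>L\<^sub>X \<le> 2 D\<close>, hence this is at most
  \<open>- 2 \<langle>W, D W\<rangle> \<le> 0\<close>. The step size thus has a factor two to spare.\<close>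

lemma trace_transpose_matrix_mult:
  fixes A B :: "real ^ 'k ^ 'n"
  shows "trace (transpose A ** B) = A \<bullet> B"
  unfolding trace_def matrix_matrix_mult_def transpose_def inner_vec_def
  by (simp add: sum.swap[of _ "UNIV :: 'n set"])

lemma matrix_diff_rdistrib:
  fixes A B :: "real ^ 'm ^ 'n"
  shows "(A - B) ** C = A ** C - B ** C"
  by (simp add: vec_eq_iff matrix_matrix_mult_def algebra_simps sum_subtractf)

lemma matrix_mult_scaleR_right:
  fixes A :: "real ^ 'm ^ 'n"
  shows "A ** (c *\<^sub>R B) = c *\<^sub>R (A ** B)"
  by (simp add: matrix_scalar_ac scalar_matrix_assoc)

lemma row_matrix_mult:
  fixes A :: "real ^ 'm ^ 'n" and B :: "real ^ 'k ^ 'm"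
  shows "(A ** B) $ i = (\<Sum>j\<in>UNIV. A $ i $ j *\<^sub>R B $ j)"
  by (simp add: vec_eq_iff matrix_matrix_mult_def)

text \<open>The nested inner product is the Frobenius one, so a quadratic form in matrices depends
  only on inner products of rows; the k columns need no separate treatment.\<close>

lemma inner_matrix_mult:
  fixes A :: "real ^ 'm ^ 'n" and B :: "real ^ 'k ^ 'm" and C :: "real ^ 'k ^ 'n"
  shows "C \<bullet> (A ** B) = (\<Sum>i\<in>UNIV. \<Sum>j\<in>UNIV. A $ i $ j * (C $ i \<bullet> B $ j))"
  by (simp add: inner_vec_def[of C] row_matrix_mult inner_sum_right)

lemma inner_matrix_mult_transpose:
  fixes A :: "real ^ 'm ^ 'n" and B :: "real ^ 'k ^ 'm" and C :: "real ^ 'k ^ 'n"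
  shows "C \<bullet> (A ** B) = B \<bullet> (transpose A ** C)"
  unfolding inner_matrix_mult
  by (subst sum.swap) (simp add: transpose_def inner_commute)

lemma inner_Diag_mult:
  fixes Z :: "real ^ 'k ^ 'n"
  shows "Z \<bullet> (Diag L ** Z) = (\<Sum>i\<in>UNIV. L $ i $ i * (Z $ i \<bullet> Z $ i))"
proof -
  have "(\<Sum>j\<in>UNIV. Diag L $ i $ j * (Z $ i \<bullet> Z $ j)) = L $ i $ i * (Z $ i \<bullet> Z $ i)" for i
    by (simp add: Diag_def if_distrib[of "\<lambda>x. x * _"] cong: if_cong)
  then show ?thesis
    by (simp add: inner_matrix_mult)
qed

lemma matrix_inv_right:
  fixes A :: "real ^ 'n ^ 'n"
  assumes "invertible A"
  shows "A ** matrix_inv A = mat 1"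
  using someI_ex[OF assms[unfolded invertible_def]] by (simp add: matrix_inv_def)

lemma invertible_Diag:
  assumes "\<And>i. L $ i $ i \<noteq> (0::real)"
  shows "invertible (Diag L)"
proof -
  have "det (Diag L) = (\<Prod>i\<in>UNIV. L $ i $ i)"
    by (subst det_diagonal) (auto simp: Diag_def)
  with assms show ?thesis
    by (simp add: invertible_det_nz)
qed

text \<open>Each cross term is at most half the sum of two squared row norms; by symmetry both
  halves add up to the same degree-weighted sum. Keeping the absolute value yields a lower and an
  upper bound at once.\<close>

lemma abs_inner_symmetric_mult_le:
  fixes W :: "real ^ 'n ^ 'n" and Z :: "real ^ 'k ^ 'n"
  assumes sym: "transpose W = W" and nonneg: "\<And>i j. 0 \<le> W $ i $ j"
  shows "\<bar>Z \<bullet> (W ** Z)\<bar> \<le> (\<Sum>i\<in>UNIV. (\<Sum>j\<in>UNIV. W $ i $ j) * (Z $ i \<bullet> Z $ i))"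
proof -
  define S where "S = (\<Sum>i\<in>UNIV. \<Sum>j\<in>UNIV. W $ i $ j * (Z $ i \<bullet> Z $ i))"
  have sym': "W $ j $ i = W $ i $ j" for i j
    using arg_cong[OF sym, of "\<lambda>A. A $ i $ j"] by (simp add: transpose_def)
  have "(\<Sum>i\<in>UNIV. \<Sum>j\<in>UNIV. W $ i $ j * (Z $ j \<bullet> Z $ j)) = S"
    unfolding S_def by (subst sum.swap) (simp add: sym')
  then have S: "(\<Sum>i\<in>UNIV. \<Sum>j\<in>UNIV. W $ i $ j * ((Z $ i \<bullet> Z $ i + Z $ j \<bullet> Z $ j) / 2)) = S"
    by (simp add: S_def distrib_left sum.distrib add_divide_distrib flip: sum_divide_distrib)
  have am_gm: "\<bar>x \<bullet> y\<bar> \<le> (x \<bullet> x + y \<bullet> y) / 2" for x y :: "real ^ 'k"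
    \<comment> \<open>The squares of \<open>x - y\<close> and \<open>x + y\<close> bound the inner
      product from above and from below.\<close>
    using inner_ge_zero[of "x - y"] inner_ge_zero[of "x + y"]
    by (simp add: algebra_simps inner_commute abs_le_iff)
  have "\<bar>Z \<bullet> (W ** Z)\<bar> \<le> (\<Sum>i\<in>UNIV. \<Sum>j\<in>UNIV. \<bar>W $ i $ j * (Z $ i \<bullet> Z $ j)\<bar>)"
    unfolding inner_matrix_mult by (intro order_trans[OF sum_abs] sum_mono sum_abs)
  also have "\<dots> \<le> (\<Sum>i\<in>UNIV. \<Sum>j\<in>UNIV. W $ i $ j * ((Z $ i \<bullet> Z $ i + Z $ j \<bullet> Z $ j) / 2))"
    unfolding abs_mult using nonneg by (intro sum_mono mult_mono am_gm) auto
  finally show ?thesis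
    unfolding S by (simp add: S_def sum_distrib_right)
qed

lemma transpose_gauss_laplacian: "transpose (gauss_laplacian A \<sigma>) = gauss_laplacian A \<sigma>"
  by (simp add: vec_eq_iff transpose_def gauss_laplacian_def norm_minus_commute)

text \<open>With at least two points, each diagonal entry is a nonempty sum of exponentials.\<close>

lemma gauss_laplacian_diag_pos:
  fixes A :: "real ^ 'd ^ 'n"
  assumes "CARD('n) \<ge> 2"
  shows "gauss_laplacian A \<sigma> $ i $ i > 0"
proof -
  have "card (UNIV - {i}) \<noteq> 0"
    using assms by (simp add: card_Diff_singleton)
  then have "UNIV - {i} \<noteq> {}"
    by (metis card.empty)
  then show ?thesis
    by (auto simp: gauss_laplacian_def intro!: sum_pos)
qed

text \<open>\<open>Diag L - L\<close> is the weighted adjacency matrix of the kernel graph, and its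
  row sums are the degrees on the diagonal of \<open>L\<close>.\<close>

lemma abs_inner_Diag_minus_gauss_laplacian_le:
  fixes A :: "real ^ 'd ^ 'n" and Z :: "real ^ 'k ^ 'n"
    and \<sigma> :: real
  defines "L \<equiv> gauss_laplacian A \<sigma>"
  shows "\<bar>Z \<bullet> ((Diag L - L) ** Z)\<bar> \<le> Z \<bullet> (Diag L ** Z)"
proof -
  have W: "(Diag L - L) $ i $ j = (if i = j then 0 else exp (- ((norm (A $ i - A $ j))\<^sup>2 / \<sigma>)))"
    for i j
    by (simp add: L_def Diag_def gauss_laplacian_def)
  have "(\<Sum>j\<in>UNIV. (Diag L - L) $ i $ j) = L $ i $ i" for i
    unfolding W by (subst sum.remove[of _ i]) (auto simp: L_def gauss_laplacian_def intro!: sum.cong)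
  moreover have "transpose (Diag L - L) = Diag L - L"
    unfolding vec_eq_iff transpose_def by (simp add: W norm_minus_commute del: vector_minus_component)
  moreover have "0 \<le> (Diag L - L) $ i $ j" for i j
    unfolding W by simp
  ultimately show ?thesis
    using abs_inner_symmetric_mult_le[of "Diag L - L" Z] by (simp add: inner_Diag_mult)
qed

text \<open>Upper half of the absolute value bound: the adjacency form is at most the degree
  form.\<close>

lemma gauss_laplacian_psd:
  fixes A :: "real ^ 'd ^ 'n" and Z :: "real ^ 'k ^ 'n"
  shows "0 \<le> Z \<bullet> (gauss_laplacian A \<sigma> ** Z)"
  using abs_inner_Diag_minus_gauss_laplacian_le[of Z A \<sigma>]
  by (simp add: matrix_diff_rdistrib inner_diff_right)

text \<open>Lower half of the same bound: the adjacency form is at least minus the degree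
  form.\<close>

lemma gauss_laplacian_le_twice_Diag:
  fixes A :: "real ^ 'd ^ 'n" and Z :: "real ^ 'k ^ 'n"
  shows "Z \<bullet> (gauss_laplacian A \<sigma> ** Z) \<le> 2 * (Z \<bullet> (Diag (gauss_laplacian A \<sigma>) ** Z))"
  using abs_inner_Diag_minus_gauss_laplacian_le[of Z A \<sigma>]
  by (simp add: matrix_diff_rdistrib inner_diff_right)

lemma objective_eq_inner:
  "objective LX LY \<alpha> Z = - (Z \<bullet> ((\<alpha> *\<^sub>R LY - LX) ** Z))"
  by (simp add: objective_def trace_transpose_matrix_mult matrix_diff_rdistrib inner_diff_right
      flip: matrix_mul_assoc scalar_matrix_assoc)

theorem theorem1:
  fixes X :: "real ^ 'd ^ 'n" and Y :: "real ^ 1 ^ 'n" and X0 :: "real ^ 'k ^ 'n"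
    and \<sigma> \<alpha> :: real and LX LY :: "real ^ 'n ^ 'n" and t :: nat
  assumes "CARD('n) \<ge> 2"
    and "\<sigma> > 0"
    and "\<alpha> \<ge> 0"
    and "LX = gauss_laplacian X \<sigma>"
    and "LY = gauss_laplacian Y \<sigma>"
    and "t \<ge> 1"
  shows "objective LX LY \<alpha> (iterate LX LY \<alpha> X0 t)
         \<le> objective LX LY \<alpha> (iterate LX LY \<alpha> X0 (t - 1))"
proof -
  define Z where "Z = iterate LX LY \<alpha> X0 (t - 1)"
  define N where "N = \<alpha> *\<^sub>R LY - LX"
  define W where "W = (1 / 2) *\<^sub>R (matrix_inv (Diag LX) ** N ** Z)"
  have "t = Suc (t - 1)"
    using assms(6) by simp
  then have step: "iterate LX LY \<alpha> X0 t = W + Z"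
    unfolding W_def N_def Z_def by (metis iterate.simps(2))
  have pos: "LX $ i $ i > 0" for i
    using gauss_laplacian_diag_pos[OF assms(1)] assms(4) by simp
  then have "invertible (Diag LX)"
    by (intro invertible_Diag) (metis less_irrefl)
  then have NZ: "N ** Z = 2 *\<^sub>R (Diag LX ** W)"
    by (simp add: W_def matrix_mult_scaleR_right matrix_mul_assoc matrix_inv_right)
  have "transpose N = N"
    using transpose_gauss_laplacian[of X \<sigma>] transpose_gauss_laplacian[of Y \<sigma>]
    by (simp add: N_def assms(4,5) vec_eq_iff transpose_def)
  \<comment> \<open>Symmetry of \<open>N\<close> merges the two cross terms of the
    expansion.\<close>
  then have "Z \<bullet> (N ** W) = W \<bullet> (N ** Z)"
    by (simp add: inner_matrix_mult_transpose[of Z])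
  then have "objective LX LY \<alpha> (W + Z)
      = objective LX LY \<alpha> Z - 2 * (W \<bullet> (N ** Z)) - W \<bullet> (N ** W)"
    by (simp add: objective_eq_inner matrix_add_ldistrib inner_add_left inner_add_right
        flip: N_def)
  \<comment> \<open>The 4 is the 2 from the cross terms times the 2 in \<open>NZ\<close>.\<close>
  also have "\<dots> = objective LX LY \<alpha> Z - 4 * (W \<bullet> (Diag LX ** W))
      + W \<bullet> (LX ** W) - \<alpha> * (W \<bullet> (LY ** W))"
    unfolding NZ
    by (simp add: N_def matrix_diff_rdistrib inner_diff_right flip: scalar_matrix_assoc)
  also have "\<dots> \<le> objective LX LY \<alpha> Z"
  proof -
    \<comment> \<open>Positivity for \<open>LX\<close> is also needed: with the bound by twice the
      diagonal form, it makes that form nonnegative.\<close>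
    have "0 \<le> W \<bullet> (LX ** W)" "0 \<le> \<alpha> * (W \<bullet> (LY ** W))"
      using assms(3) by (simp_all add: assms(4,5) gauss_laplacian_psd)
    moreover have "W \<bullet> (LX ** W) \<le> 2 * (W \<bullet> (Diag LX ** W))"
      unfolding assms(4) by (rule gauss_laplacian_le_twice_Diag)
    ultimately show ?thesis
      by linarith
  qed
  finally show ?thesis
    by (simp add: step Z_def)
qed

end
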